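(* Let $t$ be a positive integer with $t\equiv -1\pmod 4$, and let $G=C_{t(t-1)}\left(1,\frac{t(t-1)}{2}-1\right)$ be the circulant graph of order $t(t-1)$ with set of jumps $\left\{1,\frac{t(t-1)}{2}-1\right\}$. Then the harmonious chromatic number of $G$ is equal to the lower bound $\sqrt{2m+\frac14}+\frac12\le h(G)$, where $m$ denotes the number of edges of $G$; that is, $$h(G)=\sqrt{2m+\tfrac14}+\tfrac12 .$$
   Context: A harmonious $k$-coloring of a finite graph $G$ is a proper vertex $k$-coloring such that every pair of colors appears on at most one edge. The harmonious chromatic number $h(G)$ is the minimum $k$ such that $G$ has a harmonious $k$-coloring. Every graph $G$ with $m$ edges satisfies $m\le\binom{h(G)}{2}$, which gives the lower bound $\sqrt{2m+\frac14}+\frac12\le h(G)$. For $n\ge 3$ and $J\subseteq\{1,\dots,\lfloor n/2\rfloor\}\subseteq\mathbb{Z}_n$, the circulant graph $C_n(J)$ has vertex set $\mathbb{Z}_n$ and edge set $\{ij: |\{i-j,j-i\}\cap J|=1\}$; $J$ is called the set of jumps of $C_n(J)$.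
   Formalization: The displayed equality cannot hold literally, since the bound is never an integer here (for t=3, m=12, it is about 5.42 while h(G)=6); the formal statement says h(G) equals the ceiling of sqrt(2m+1/4)+1/2. *)

theory Defs
  imports Complex_Main "HOL-Number_Theory.Cong"
begin

type_synonym 'a graph = "'a set \<times> 'a set set"

abbreviation verts :: "'a graph \<Rightarrow> 'a set" where "verts G \<equiv> fst G"
abbreviation edges :: "'a graph \<Rightarrow> 'a set set" where "edges G \<equiv> snd G"

definition finite_simple_graph :: "'a graph \<Rightarrow> bool" where
  "finite_simple_graph G \<longleftrightarrow>
     finite (verts G) \<and> (\<forall>e\<in>edges G. e \<subseteq> verts G \<and> card e = 2)"

definition proper_coloring :: "'a graph \<Rightarrow> nat \<Rightarrow> ('a \<Rightarrow> nat) \<Rightarrow> bool" where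
  "proper_coloring G k c \<longleftrightarrow>
     (\<forall>v\<in>verts G. c v < k) \<and> (\<forall>u v. {u, v} \<in> edges G \<longrightarrow> c u \<noteq> c v)"

text \<open>For an edge \<open>e\<close>, the image \<open>c ` e\<close> is the pair of colors appearing on \<open>e\<close>.\<close>

definition harmonious_coloring :: "'a graph \<Rightarrow> nat \<Rightarrow> ('a \<Rightarrow> nat) \<Rightarrow> bool" where
  "harmonious_coloring G k c \<longleftrightarrow>
     proper_coloring G k c \<and> (\<forall>e\<in>edges G. \<forall>f\<in>edges G. c ` e = c ` f \<longrightarrow> e = f)"

definition harmonious_chromatic_number :: "'a graph \<Rightarrow> nat" where
  "harmonious_chromatic_number G = (LEAST k. \<exists>c. harmonious_coloring G k c)"

text \<open>\<open>\<int>\<^sub>n\<close> is represented by the residues \<open>0, \<dots>, n - 1\<close>, with subtraction taken modulo \<open>n\<close>.\<close>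

definition circulant_graph :: "int \<Rightarrow> int set \<Rightarrow> int graph" where
  "circulant_graph n J =
     ({0..<n},
      {{i, j} | i j. i \<in> {0..<n} \<and> j \<in> {0..<n} \<and>
         card ({(i - j) mod n, (j - i) mod n} \<inter> J) = 1})"

lemma circulant_graph_simple:
  assumes "J \<subseteq> {1..n div 2}"
  shows "finite_simple_graph (circulant_graph n J)"
proof -
  have "i \<noteq> j" if "card ({(i - j) mod n, (j - i) mod n} \<inter> J) = 1" for i j
  proof
    assume "i = j"
    then have "{(i - j) mod n, (j - i) mod n} \<inter> J = {}" using assms by auto
    with that show False by simp
  qed
  then have "card {i, j} = 2" if "card ({(i - j) mod n, (j - i) mod n} \<inter> J) = 1" for i j
    using that by simp
  then have "card e = 2" if "e \<in> edges (circulant_graph n J)" for e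
    using that unfolding circulant_graph_def by force
  moreover have "e \<subseteq> {0..<n}" if "e \<in> edges (circulant_graph n J)" for e
    using that unfolding circulant_graph_def by force
  ultimately show ?thesis
    by (simp add: finite_simple_graph_def) (simp add: circulant_graph_def)
qed

text \<open>The minimum in the definition of the harmonious chromatic number is attained.\<close>

lemma harmonious_coloring_exists:
  assumes "finite_simple_graph G"
  shows "\<exists>c. harmonious_coloring G (harmonious_chromatic_number G) c"
proof -
  have "finite (verts G)" using assms by (simp add: finite_simple_graph_def)
  then obtain c :: "'a \<Rightarrow> nat" and k where c: "c ` verts G = {i. i < k}" "inj_on c (verts G)"
    using finite_imp_inj_to_nat_seg by metis
  have sub: "e \<subseteq> verts G" and card2: "card e = 2" if "e \<in> edges G" for e
    using assms that by (auto simp: finite_simple_graph_def)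
  have "c u \<noteq> c v" if "{u, v} \<in> edges G" for u v
  proof -
    have "u \<noteq> v" using card2[OF that] by auto
    then show ?thesis using sub[OF that] c(2) by (auto dest: inj_onD)
  qed
  moreover have "e = f" if "e \<in> edges G" "f \<in> edges G" "c ` e = c ` f" for e f
    using inj_on_image_eq_iff[OF c(2) sub[OF that(1)] sub[OF that(2)]] that(3) by simp
  moreover have "c v < k" if "v \<in> verts G" for v using that c(1) by auto
  ultimately have "\<exists>c. harmonious_coloring G k c"
    unfolding harmonious_coloring_def proper_coloring_def by blast
  then show ?thesis
    unfolding harmonious_chromatic_number_def by (rule LeastI)
qed

end

theory Submission imports Defs
begin

text \<open>Let \<open>N = t (t - 1) / 2\<close>, so that the graph is \<open>C\<^bsub>2N\<^esub>(1, N - 1)\<close>. The congruence on \<open>t\<close> makes both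
  \<open>t\<close> and \<open>N\<close> odd. By the Chinese remainder theorem a vertex \<open>w\<close> is then the same thing as the pair
  \<open>(w mod N, w mod 2)\<close>. Modulo \<open>N\<close> the jumps \<open>1\<close> and \<open>N - 1\<close> are \<open>1\<close> and \<open>-1\<close>; modulo \<open>2\<close> they are
  \<open>1\<close> and \<open>0\<close>. So \<open>(x, \<epsilon>)\<close> and \<open>(y, \<delta>)\<close> are adjacent iff \<open>y = x \<plusminus> 1\<close>, whatever the parities are: the
  graph is the cycle of length \<open>N\<close> with every vertex doubled.

  The number \<open>N\<close> is also the number of edges of the complete graph \<open>K\<^sub>t\<close>, which has an Eulerian
  circuit \<open>v\<close> because \<open>t\<close> is odd. Color \<open>(x, \<epsilon>)\<close> by \<open>(v x, \<epsilon>)\<close>, with \<open>2 t\<close> colors in all. An edge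
  then gets the color pair \<open>{(v x, \<epsilon>), (v (x + 1), \<delta>)}\<close>; the edge \<open>{v x, v (x + 1)}\<close> of \<open>K\<^sub>t\<close>
  determines \<open>x\<close>, and \<open>v x \<noteq> v (x + 1)\<close> tells which parity belongs to which end. Hence the coloring
  is harmonious (\<open>harmonious_coloring_from_closed_trail\<close>). The circuit comes from Walecki's
  decomposition of \<open>K\<^sub>t\<close> into Hamiltonian cycles, joined at a common vertex
  (\<open>walecki_circuit_closed_trail\<close>).

  For optimality, the two jumps and their negatives are four distinct residues, so \<open>m = 2 n = 2 t (t - 1)\<close>
  (\<open>card_circulant_edges\<close>). This is only \<open>t\<close> below the binomial coefficient of \<open>2 t\<close> over \<open>2\<close>, and
  the counting bound already rounds up to \<open>2 t\<close>. It is not an integer itself, so the equality in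
  question is with its ceiling.\<close>

section \<open>The lower bound\<close>

text \<open>Taking an edge to its pair of colors is injective.\<close>

lemma card_edges_le_choose_colors:
  assumes simple: "finite_simple_graph G" and col: "harmonious_coloring G k c"
  shows "card (edges G) \<le> k choose 2"
proof -
  let ?P = "{K. K \<subseteq> {..<k} \<and> card K = 2}"
  have "inj_on ((`) c) (edges G)"
    using col by (auto simp: harmonious_coloring_def inj_on_def)
  moreover have "(`) c ` edges G \<subseteq> ?P"
  proof
    fix K assume "K \<in> (`) c ` edges G"
    then obtain e where e: "e \<in> edges G" "K = c ` e" by blast
    then have "e \<subseteq> verts G" "card e = 2"
      using simple by (auto simp: finite_simple_graph_def)
    moreover from this obtain u v where "e = {u, v}" by (auto simp: card_2_iff)
    ultimately show "K \<in> ?P"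
      using col e by (auto simp: harmonious_coloring_def proper_coloring_def)
  qed
  ultimately have "card (edges G) \<le> card ?P"
    by (intro card_inj_on_le) auto
  then show ?thesis by (simp add: n_subsets)
qed

lemma harmonious_chromatic_number_lower_bound:
  assumes simple: "finite_simple_graph G" and "verts G \<noteq> {}"
  shows "sqrt (2 * real (card (edges G)) + 1 / 4) + 1 / 2 \<le> real (harmonious_chromatic_number G)"
proof -
  let ?h = "harmonious_chromatic_number G" and ?m = "card (edges G)"
  obtain c where c: "harmonious_coloring G ?h c"
    using harmonious_coloring_exists[OF simple] by blast
  have "1 \<le> ?h"
    using c assms(2) by (force simp: harmonious_coloring_def proper_coloring_def)
  have "2 * ?m \<le> ?h * (?h - 1)"
    using card_edges_le_choose_colors[OF simple c] by (simp add: choose_two)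
  then have "real (2 * ?m) \<le> real (?h * (?h - 1))" by (simp only: of_nat_le_iff)
  then have "2 * real ?m + 1 / 4 \<le> (real ?h - 1 / 2)\<^sup>2"
    using \<open>1 \<le> ?h\<close> by (simp add: power2_eq_square algebra_simps of_nat_diff)
  then have "sqrt (2 * real ?m + 1 / 4) \<le> real ?h - 1 / 2"
    using \<open>1 \<le> ?h\<close> by (intro real_le_lsqrt) auto
  then show ?thesis by simp
qed

section \<open>Edges of circulant graphs\<close>

text \<open>When every jump is below \<open>n / 2\<close>, each edge has a unique end from which it is a forward
  jump. This turns the edge set into an explicit image, suited to counting and to case analysis
  on the jump.\<close>

lemma circulant_edges_eq_image:
  assumes J: "\<And>d. d \<in> J \<Longrightarrow> 0 < d \<and> 2 * d < n"
  shows "edges (circulant_graph n J) = (\<lambda>(w, d). {w, (w + d) mod n}) ` ({0..<n} \<times> J)"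
proof (intro subset_antisym subsetI)
  fix e assume "e \<in> edges (circulant_graph n J)"
  then obtain i j where e: "e = {i, j}" "i \<in> {0..<n}" "j \<in> {0..<n}"
    and c: "card ({(i - j) mod n, (j - i) mod n} \<inter> J) = 1"
    by (auto simp: circulant_graph_def)
  from c have "{(i - j) mod n, (j - i) mod n} \<inter> J \<noteq> {}" by (metis card.empty zero_neq_one)
  then consider "(i - j) mod n \<in> J" | "(j - i) mod n \<in> J" by blast
  then show "e \<in> (\<lambda>(w, d). {w, (w + d) mod n}) ` ({0..<n} \<times> J)"
  proof cases
    case 1
    moreover have "(j + (i - j) mod n) mod n = i" using e by (simp add: mod_simps)
    ultimately show ?thesis using e
      by (intro image_eqI[of _ _ "(j, (i - j) mod n)"]) auto
  next
    case 2
    moreover have "(i + (j - i) mod n) mod n = j" using e by (simp add: mod_simps)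
    ultimately show ?thesis using e
      by (intro image_eqI[of _ _ "(i, (j - i) mod n)"]) auto
  qed
next
  fix e assume "e \<in> (\<lambda>(w, d). {w, (w + d) mod n}) ` ({0..<n} \<times> J)"
  then obtain w d where e: "e = {w, (w + d) mod n}" "w \<in> {0..<n}" "d \<in> J" by auto
  have d: "0 < d" "2 * d < n" using J[OF e(3)] by auto
  have "((w + d) mod n - w) mod n = d" using d by (simp add: mod_simps)
  moreover have "(w - (w + d) mod n) mod n = n - d"
    using d by (simp add: mod_simps zmod_zminus1_eq_if)
  \<comment> \<open>The reverse difference exceeds \<open>n / 2\<close>, so exactly one of the two is a jump.\<close>
  moreover have "n - d \<notin> J" using J[of "n - d"] d by auto
  ultimately have "card ({(w - (w + d) mod n) mod n, ((w + d) mod n - w) mod n} \<inter> J) = 1"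
    using e(3) by simp
  then show "e \<in> edges (circulant_graph n J)"
    using e d unfolding circulant_graph_def snd_conv
    by (intro CollectI exI[of _ w] exI[of _ "(w + d) mod n"]) auto
qed

lemma card_circulant_edges:
  assumes J: "\<And>d. d \<in> J \<Longrightarrow> 0 < d \<and> 2 * d < n"
  shows "card (edges (circulant_graph n J)) = nat n * card J"
proof -
  have "inj_on (\<lambda>(w, d). {w, (w + d) mod n}) ({0..<n} \<times> J)"
  proof (rule inj_onI, clarify)
    fix w d w' d'
    assume w: "w \<in> {0..<n}" "w' \<in> {0..<n}" and dJ: "d \<in> J" "d' \<in> J"
      and eq: "{w, (w + d) mod n} = {w', (w' + d') mod n}"
    have d: "0 < d" "2 * d < n" "0 < d'" "2 * d' < n" using J dJ by auto
    from eq consider "w = w'" "(w + d) mod n = (w' + d') mod n"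
      | "w = (w' + d') mod n" "(w + d) mod n = w'"
      by (auto simp: doubleton_eq_iff)
    then show "w = w' \<and> d = d'"
    proof cases
      case 1
      then have "((w + d) mod n - w) mod n = ((w + d') mod n - w) mod n" by simp
      then show ?thesis using 1 d by (simp add: mod_simps)
    next
      case 2
      \<comment> \<open>Walking along both jumps would return to the start, but \<open>d + d'\<close> is less than \<open>n\<close>.\<close>
      have "(w + (d + d')) mod n = ((w + d) mod n + d') mod n" by (simp add: mod_simps algebra_simps)
      also have "\<dots> = w" using 2 by simp
      finally have "((w + (d + d')) mod n - w) mod n = 0" by simp
      then show ?thesis using d by (simp add: mod_simps)
    qed
  qed
  then show ?thesis
    using circulant_edges_eq_image[OF J] by (simp add: card_image card_cartesian_product)
qed

section \<open>An Eulerian circuit of a complete graph of odd order\<close>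

text \<open>A closed trail of length \<open>N\<close> in the complete graph on \<open>{0..<k}\<close>, with vertices indexed by all
  integers and closed up by \<open>v N = v 0\<close>; outside \<open>{0..N}\<close> only the range is constrained. For
  \<open>N = k (k - 1) / 2\<close> it is an Eulerian circuit.\<close>

definition closed_trail :: "int \<Rightarrow> int \<Rightarrow> (int \<Rightarrow> int) \<Rightarrow> bool" where
  "closed_trail k N v \<longleftrightarrow>
     (\<forall>p. v p \<in> {0..<k}) \<and> v N = v 0 \<and> (\<forall>p\<in>{0..<N}. v p \<noteq> v (p + 1)) \<and>
     inj_on (\<lambda>p. {v p, v (p + 1)}) {0..<N}"

text \<open>The sequence \<open>0, 1, -1, 2, -2, \<dots>, r\<close>, at the positions \<open>1, \<dots>, 2 r\<close>.\<close>

definition zigzag :: "int \<Rightarrow> int" where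
  "zigzag s = (if even s then s div 2 else - (s div 2))"

text \<open>The \<open>i\<close>-th Hamiltonian cycle in Walecki's decomposition of \<open>K\<^bsub>2r+1\<^esub>\<close>: it starts and ends at
  the hub \<open>2 r\<close> and in between traverses the rim \<open>\<int>\<^bsub>2r\<^esub>\<close> along the zigzag path rotated by \<open>i\<close>.\<close>

definition walecki_cycle :: "int \<Rightarrow> int \<Rightarrow> int \<Rightarrow> int" where
  "walecki_cycle r i s =
     (if s = 0 \<or> s = 2 * r + 1 then 2 * r else (i + zigzag s) mod (2 * r))"

text \<open>The cycles \<open>0, \<dots>, r - 1\<close> one after the other, the end of each being the start of the next.\<close>

definition walecki_circuit :: "int \<Rightarrow> int \<Rightarrow> int" where
  "walecki_circuit r p = walecki_cycle r (p div (2 * r + 1)) (p mod (2 * r + 1))"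

text \<open>Consecutive zigzag terms have the alternating sums \<open>1, 0, 1, 0, \<dots>\<close>; rotation by \<open>i\<close> adds
  \<open>2 i\<close>. These sums are what separates the edges of different cycles.\<close>

lemma zigzag_add_zigzag_Suc: "zigzag s + zigzag (s + 1) = s mod 2"
  unfolding zigzag_def by presburger

text \<open>The terms at positions \<open>1, \<dots>, 2 r\<close> are distinct integers in \<open>(-r, r]\<close>, which is a complete
  residue system modulo \<open>2 r\<close>.\<close>

lemma zigzag_cong_imp_eq:
  assumes "s \<in> {1..2 * r}" "s' \<in> {1..2 * r}" "[zigzag s = zigzag s'] (mod 2 * r)"
  shows "s = s'"
proof -
  have range: "- r < zigzag a \<and> zigzag a \<le> r" if "a \<in> {1..2 * r}" for a
    using that unfolding zigzag_def atLeastAtMost_iff by presburger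
  have "\<bar>zigzag s - zigzag s'\<bar> < 2 * r"
    using range[OF assms(1)] range[OF assms(2)] by linarith
  moreover have "2 * r dvd zigzag s - zigzag s'"
    using assms(3) by (simp add: cong_iff_dvd_diff)
  ultimately have "zigzag s = zigzag s'"
    using zdvd_imp_le[of "2 * r" "\<bar>zigzag s - zigzag s'\<bar>"] by force
  then show ?thesis
    using assms(1,2) unfolding zigzag_def by (auto elim!: oddE evenE split: if_splits)
qed

lemma walecki_cycle_hub_iff:
  assumes "0 < r" "s \<in> {0..2 * r + 1}"
  shows "walecki_cycle r i s = 2 * r \<longleftrightarrow> s = 0 \<or> s = 2 * r + 1"
proof -
  have "(i + zigzag s) mod (2 * r) < 2 * r" using assms by simp
  then show ?thesis unfolding walecki_cycle_def by auto
qed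

lemma walecki_cycle_hamiltonian:
  assumes r: "0 < r" and s: "s \<in> {0..2 * r + 1}" "s' \<in> {0..2 * r + 1}"
    and eq: "walecki_cycle r i s = walecki_cycle r i s'"
  shows "s = s' \<or> {s, s'} = {0, 2 * r + 1}"
proof (cases "s = 0 \<or> s = 2 * r + 1")
  case True
  then show ?thesis
    using walecki_cycle_hub_iff[OF r s(1), of i] walecki_cycle_hub_iff[OF r s(2), of i] eq by auto
next
  case False
  then have "s' \<noteq> 0" "s' \<noteq> 2 * r + 1"
    using walecki_cycle_hub_iff[OF r s(1), of i] walecki_cycle_hub_iff[OF r s(2), of i] eq by auto
  with False eq have "[i + zigzag s = i + zigzag s'] (mod 2 * r)"
    by (simp add: walecki_cycle_def cong_def)
  then have "[zigzag s = zigzag s'] (mod 2 * r)" by (simp only: cong_add_lcancel)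
  then show ?thesis
    using zigzag_cong_imp_eq[of s r s'] s False \<open>s' \<noteq> 0\<close> \<open>s' \<noteq> 2 * r + 1\<close> by auto
qed

lemma walecki_cycle_spokes:
  assumes "i \<in> {0..<r}"
  shows "walecki_cycle r i 1 = i" "walecki_cycle r i (2 * r) = i + r"
  using assms by (auto simp: walecki_cycle_def zigzag_def)

lemma walecki_cycle_rim_sum:
  assumes "i \<in> {0..<r}" "s \<in> {1..<2 * r}"
  shows "(walecki_cycle r i s + walecki_cycle r i (s + 1)) mod (2 * r) = 2 * i + s mod 2"
proof -
  have "(walecki_cycle r i s + walecki_cycle r i (s + 1)) mod (2 * r)
      = ((i + zigzag s) mod (2 * r) + (i + zigzag (s + 1)) mod (2 * r)) mod (2 * r)"
    using assms by (auto simp: walecki_cycle_def)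
  also have "\<dots> = (2 * i + (zigzag s + zigzag (s + 1))) mod (2 * r)"
    unfolding mod_add_eq by (simp add: algebra_simps)
  also have "\<dots> = 2 * i + s mod 2"
  proof -
    have "0 \<le> s mod 2" "s mod 2 < 2" by simp_all
    then have "0 \<le> 2 * i + s mod 2" "2 * i + s mod 2 < 2 * r" using assms by auto
    then show ?thesis unfolding zigzag_add_zigzag_Suc by simp
  qed
  finally show ?thesis .
qed

text \<open>A rim edge of cycle \<open>i\<close> has end sum \<open>2 i\<close> or \<open>2 i + 1\<close> modulo \<open>2 r\<close>, and an edge at the hub has
  rim end \<open>i\<close> or \<open>i + r\<close>. Since \<open>0 \<le> i < r\<close>, either piece of information gives back \<open>i\<close>.\<close>

lemma walecki_cycles_edge_disjoint:
  assumes i: "i \<in> {0..<r}" "j \<in> {0..<r}" and s: "s \<in> {0..2 * r}" "s' \<in> {0..2 * r}"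
    and eq: "{walecki_cycle r i s, walecki_cycle r i (s + 1)}
           = {walecki_cycle r j s', walecki_cycle r j (s' + 1)}"
  shows "i = j"
proof -
  have r: "0 < r" using i by auto
  have hub: "2 * r \<in> {walecki_cycle r a b, walecki_cycle r a (b + 1)} \<longleftrightarrow> b = 0 \<or> b = 2 * r"
    if "b \<in> {0..2 * r}" for a b
    using that walecki_cycle_hub_iff[OF r, of b a] walecki_cycle_hub_iff[OF r, of "b + 1" a] by auto
  show ?thesis
  proof (cases "s = 0 \<or> s = 2 * r")
    case True
    then have s': "s' = 0 \<or> s' = 2 * r" using hub[OF s(1)] hub[OF s(2)] eq by metis
    have spoke: "\<exists>x\<in>{a, a + r}. {walecki_cycle r a b, walecki_cycle r a (b + 1)} = {2 * r, x}"
      if a: "a \<in> {0..<r}" and b: "b = 0 \<or> b = 2 * r" for a b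
      using b
    proof
      assume "b = 0"
      then have "{walecki_cycle r a b, walecki_cycle r a (b + 1)} = {2 * r, a}"
        using walecki_cycle_spokes(1)[OF a] by (simp add: walecki_cycle_def[of r a 0])
      then show ?thesis by blast
    next
      assume "b = 2 * r"
      then have "{walecki_cycle r a b, walecki_cycle r a (b + 1)} = {2 * r, a + r}"
        using walecki_cycle_spokes(2)[OF a]
        by (simp add: walecki_cycle_def[of r a "2 * r + 1"] insert_commute)
      then show ?thesis by blast
    qed
    obtain x y where "x \<in> {i, i + r}" "y \<in> {j, j + r}" "{2 * r, x} = {2 * r, y}"
      using spoke[OF i(1) True] spoke[OF i(2) s'] eq by metis
    then show ?thesis using i by (auto simp: doubleton_eq_iff)
  next
    case False
    then have "\<not> (s' = 0 \<or> s' = 2 * r)" using hub[OF s(1)] hub[OF s(2)] eq by metis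
    with False s have rim: "s \<in> {1..<2 * r}" "s' \<in> {1..<2 * r}" by auto
    have "walecki_cycle r i s + walecki_cycle r i (s + 1)
        = walecki_cycle r j s' + walecki_cycle r j (s' + 1)"
      using eq by (auto simp: doubleton_eq_iff)
    then have "2 * i + s mod 2 = 2 * j + s' mod 2"
      using walecki_cycle_rim_sum[OF i(1) rim(1)] walecki_cycle_rim_sum[OF i(2) rim(2)] by simp
    then show ?thesis by presburger
  qed
qed

text \<open>Within one cycle, an edge determines its position because the vertices are distinct.\<close>

lemma walecki_cycles_decompose:
  assumes i: "i \<in> {0..<r}" "j \<in> {0..<r}" and s: "s \<in> {0..2 * r}" "s' \<in> {0..2 * r}"
    and eq: "{walecki_cycle r i s, walecki_cycle r i (s + 1)}
           = {walecki_cycle r j s', walecki_cycle r j (s' + 1)}"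
  shows "i = j \<and> s = s'"
proof
  show ij: "i = j" by (rule walecki_cycles_edge_disjoint[OF assms])
  have r: "0 < r" using i by auto
  note ham = walecki_cycle_hamiltonian[OF r, where i = j]
  from eq ij consider "walecki_cycle r j s = walecki_cycle r j s'"
      "walecki_cycle r j (s + 1) = walecki_cycle r j (s' + 1)"
    | "walecki_cycle r j s = walecki_cycle r j (s' + 1)"
      "walecki_cycle r j (s + 1) = walecki_cycle r j s'"
    by (auto simp: doubleton_eq_iff)
  then show "s = s'"
  proof cases
    case 1
    then show ?thesis using ham[of s s'] s by (auto simp: doubleton_eq_iff)
  next
    case 2
    \<comment> \<open>The edge is met in opposite directions: around the cycle \<open>s = s' + 1\<close> and \<open>s' = s + 1\<close>, so
      that its length \<open>2 r + 1\<close> would divide \<open>2\<close>.\<close>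
    then show ?thesis using ham[of s "s' + 1"] ham[of "s + 1" s'] s r
      by (auto simp: doubleton_eq_iff; presburger)
  qed
qed

theorem walecki_circuit_closed_trail:
  assumes r: "0 < r"
  shows "closed_trail (2 * r + 1) (r * (2 * r + 1)) (walecki_circuit r)"
proof -
  let ?t = "2 * r + 1"
  have row: "p div ?t \<in> {0..<r} \<and> p mod ?t \<in> {0..2 * r}" if "p \<in> {0..<r * ?t}" for p
  proof -
    have "p mod ?t < ?t" by (rule pos_mod_bound) (use r in simp)
    moreover have "0 \<le> p mod ?t" by (rule pos_mod_sign) (use r in simp)
    moreover have "p div ?t < r"
    proof (rule ccontr)
      assume "\<not> p div ?t < r"
      then have "?t * r \<le> ?t * (p div ?t)" using r by (intro mult_left_mono) auto
      also have "\<dots> \<le> p"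
        using mult_div_mod_eq[of ?t p] \<open>0 \<le> p mod ?t\<close> by linarith
      finally show False using that by (simp add: mult.commute)
    qed
    moreover have "0 \<le> p div ?t"
      using that r by (simp add: pos_imp_zdiv_nonneg_iff)
    ultimately show ?thesis by simp
  qed
  have Suc: "walecki_circuit r (p + 1) = walecki_cycle r (p div ?t) (p mod ?t + 1)"
    if "p \<in> {0..<r * ?t}" for p
  proof (cases "p mod ?t = 2 * r")
    case True
    \<comment> \<open>The next row starts at the hub, where the current row ends.\<close>
    then have "(p + 1) mod ?t = ?t mod ?t"
      unfolding mod_add_left_eq[of p ?t 1, symmetric] by (simp only:)
    then show ?thesis using True by (simp add: walecki_circuit_def walecki_cycle_def)
  next
    case False
    then have small: "0 \<le> p mod ?t + 1" "p mod ?t + 1 < ?t"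
      using row[OF that] unfolding atLeastAtMost_iff by linarith+
    have "p + 1 = ?t * (p div ?t) + (p mod ?t + 1)"
      using mult_div_mod_eq[of ?t p] by linarith
    then have "(p + 1) div ?t = p div ?t" "(p + 1) mod ?t = p mod ?t + 1"
      using small by (rule int_div_pos_eq, rule int_mod_pos_eq)
    then show ?thesis by (simp add: walecki_circuit_def)
  qed
  have "walecki_circuit r p \<in> {0..<?t}" for p
  proof -
    have "0 \<le> a mod (2 * r) \<and> a mod (2 * r) < 2 * r" for a using r by simp
    then show ?thesis using r by (simp add: walecki_circuit_def walecki_cycle_def less_imp_le less_Suc_eq)
  qed
  moreover have "walecki_circuit r (r * ?t) = walecki_circuit r 0"
    by (simp add: walecki_circuit_def walecki_cycle_def)
  moreover have "walecki_circuit r p \<noteq> walecki_circuit r (p + 1)" if p: "p \<in> {0..<r * ?t}" for p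
  proof
    assume "walecki_circuit r p = walecki_circuit r (p + 1)"
    then have "walecki_cycle r (p div ?t) (p mod ?t) = walecki_cycle r (p div ?t) (p mod ?t + 1)"
      by (simp add: Suc[OF p]) (simp add: walecki_circuit_def)
    from walecki_cycle_hamiltonian[OF r _ _ this] show False
      using row[OF p] r by (auto simp: doubleton_eq_iff)
  qed
  moreover have "inj_on (\<lambda>p. {walecki_circuit r p, walecki_circuit r (p + 1)}) {0..<r * ?t}"
  proof (rule inj_onI)
    fix p q assume p: "p \<in> {0..<r * ?t}" and q: "q \<in> {0..<r * ?t}"
      and "{walecki_circuit r p, walecki_circuit r (p + 1)}
         = {walecki_circuit r q, walecki_circuit r (q + 1)}"
    then have "p div ?t = q div ?t \<and> p mod ?t = q mod ?t"
      unfolding Suc[OF p] Suc[OF q] unfolding walecki_circuit_def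
      using row[OF p] row[OF q] by (intro walecki_cycles_decompose) auto
    then have "?t * (p div ?t) + p mod ?t = ?t * (q div ?t) + q mod ?t" by (simp only:)
    then show "p = q" by (simp only: mult_div_mod_eq)
  qed
  ultimately show ?thesis unfolding closed_trail_def by blast
qed

section \<open>Coloring the doubled cycle\<close>

text \<open>The step from \<open>N - 1\<close> to \<open>N\<close> becomes a step to \<open>0\<close> after reduction modulo \<open>N\<close>, which the
  closing condition allows.\<close>

lemma closed_trail_Suc_mod:
  assumes "closed_trail k N v" "0 < N" "[b = a + 1] (mod N)"
  shows "v (b mod N) = v (a mod N + 1)"
proof (cases "a mod N + 1 = N")
  case True
  have "b mod N = (a mod N + 1) mod N" using assms(3) by (simp add: cong_def mod_simps)
  then show ?thesis using True assms(1) by (simp add: closed_trail_def)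
next
  case False
  moreover have "a mod N < N" "0 \<le> a mod N" using assms(2) by simp_all
  ultimately have "(a mod N + 1) mod N = a mod N + 1" by simp
  moreover have "b mod N = (a mod N + 1) mod N" using assms(3) by (simp add: cong_def mod_simps)
  ultimately show ?thesis by simp
qed

text \<open>A jump by \<open>1\<close> is already oriented; a jump by \<open>N - 1\<close> is a step back modulo \<open>N\<close> and is read from
  its other end.\<close>

lemma doubled_cycle_edge_orientation:
  assumes "3 \<le> N" "e \<in> edges (circulant_graph (2 * N) {1, N - 1})"
  obtains a b where "e = {a, b}" "a \<in> {0..<2 * N}" "b \<in> {0..<2 * N}" "[b = a + 1] (mod N)"
proof -
  have "edges (circulant_graph (2 * N) {1, N - 1})
      = (\<lambda>(w, d). {w, (w + d) mod (2 * N)}) ` ({0..<2 * N} \<times> {1, N - 1})"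
    by (rule circulant_edges_eq_image) (use assms(1) in auto)
  with assms(2) have "e \<in> (\<lambda>(w, d). {w, (w + d) mod (2 * N)}) ` ({0..<2 * N} \<times> {1, N - 1})"
    by (simp only:)
  then obtain w d where
    e: "e = {w, (w + d) mod (2 * N)}" "w \<in> {0..<2 * N}" "d \<in> {1, N - 1}"
    by (elim imageE SigmaE) (simp only: prod.case)
  let ?u = "(w + d) mod (2 * N)"
  have u: "?u \<in> {0..<2 * N}" using assms(1) by simp
  have u_cong: "[?u = w + d] (mod N)" by (simp add: cong_def mod_mod_cancel)
  show thesis
  proof (cases "d = 1")
    case True
    then show ?thesis using that[of w ?u] e u u_cong by simp
  next
    case False
    then have "[?u + 1 = w + (N - 1) + 1] (mod N)" using u_cong e(3) by (intro cong_add) auto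
    then have "[w = ?u + 1] (mod N)" by (simp add: cong_def)
    then show ?thesis using that[of ?u w] e u by (simp add: insert_commute)
  qed
qed

text \<open>The color \<open>2 v + \<epsilon>\<close> encodes the pair \<open>(v, \<epsilon>)\<close>. The trail property recovers from a color pair the
  position modulo \<open>N\<close> of both ends of the edge, and the parities recover the ends, as \<open>N\<close> is odd.\<close>

theorem harmonious_coloring_from_closed_trail:
  assumes N: "3 \<le> N" "odd N" and trail: "closed_trail k N v"
  shows "harmonious_coloring (circulant_graph (2 * N) {1, N - 1}) (nat (2 * k))
           (\<lambda>w. nat (2 * v (w mod N) + w mod 2))" (is "harmonious_coloring ?G _ ?c")
proof -
  have v: "0 \<le> v p" "v p < k" for p using trail by (auto simp: closed_trail_def)
  have c_eq: "v (w mod N) = v (w' mod N) \<and> w mod 2 = w' mod 2" if "?c w = ?c w'" for w w'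
  proof -
    have "2 * v (w mod N) + w mod 2 = 2 * v (w' mod N) + w' mod 2"
      using that v[of "w mod N"] v[of "w' mod N"] by (simp add: eq_nat_nat_iff)
    then show ?thesis by presburger
  qed
  have pos: "a mod N \<in> {0..<N}" for a using N by simp
  have step: "v (b mod N) = v (a mod N + 1)" "v (a mod N) \<noteq> v (b mod N)"
    if "[b = a + 1] (mod N)" for a b
  proof -
    show "v (b mod N) = v (a mod N + 1)"
      using closed_trail_Suc_mod[OF trail _ that] N by simp
    then show "v (a mod N) \<noteq> v (b mod N)"
      using trail pos[of a] by (simp add: closed_trail_def)
  qed
  have CRT: "w = w'" if "w \<in> {0..<2 * N}" "w' \<in> {0..<2 * N}" "w mod 2 = w' mod 2"
    "[w = w'] (mod N)" for w w'
  proof -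
    have "[w = w'] (mod 2)" using that(3) by (simp add: cong_def)
    moreover have "coprime 2 N" using N(2) by simp
    ultimately have "[w = w'] (mod 2 * N)" using that(4) by (intro coprime_cong_mult) auto
    then show ?thesis using that(1,2) by (simp add: cong_def)
  qed
  have distinct: "e = f" if ef: "e \<in> edges ?G" "f \<in> edges ?G" "?c ` e = ?c ` f" for e f
  proof -
    obtain a b where e: "e = {a, b}" "a \<in> {0..<2 * N}" "b \<in> {0..<2 * N}" "[b = a + 1] (mod N)"
      using doubled_cycle_edge_orientation[OF N(1) ef(1)] .
    obtain a' b' where f: "f = {a', b'}" "a' \<in> {0..<2 * N}" "b' \<in> {0..<2 * N}"
      "[b' = a' + 1] (mod N)"
      using doubled_cycle_edge_orientation[OF N(1) ef(2)] .
    have match: "?c a = ?c a' \<and> ?c b = ?c b' \<or> ?c a = ?c b' \<and> ?c b = ?c a'"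
      using ef(3) unfolding e(1) f(1) by (simp only: image_insert image_empty doubleton_eq_iff)
    then have "v (a mod N) = v (a' mod N) \<and> v (b mod N) = v (b' mod N) \<or>
        v (a mod N) = v (b' mod N) \<and> v (b mod N) = v (a' mod N)"
      using c_eq[of a a'] c_eq[of b b'] c_eq[of a b'] c_eq[of b a'] by argo
    then have "{v (a mod N), v (b mod N)} = {v (a' mod N), v (b' mod N)}"
      by (simp only: doubleton_eq_iff)
    then have "{v (a mod N), v (a mod N + 1)} = {v (a' mod N), v (a' mod N + 1)}"
      using step(1)[OF e(4)] step(1)[OF f(4)] by simp
    then have a: "a mod N = a' mod N"
      using trail pos[of a] pos[of a'] by (simp add: closed_trail_def inj_on_def)
    then have "[a + 1 = a' + 1] (mod N)" by (intro cong_add) (simp_all add: cong_def)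
    then have b: "[b = b'] (mod N)" using e(4) f(4) cong_trans cong_sym by meson
    \<comment> \<open>The crossed matching would give \<open>a\<close> and \<open>b\<close> the same vertex of the trail.\<close>
    have "?c a = ?c a'" "?c b = ?c b'"
      using match c_eq[of a b'] step(2)[OF e(4)] b unfolding cong_def by argo+
    then have "a mod 2 = a' mod 2" "b mod 2 = b' mod 2" by (blast dest: c_eq)+
    then have "a = a'" "b = b'"
      using CRT[OF e(2) f(2)] CRT[OF e(3) f(3)] a b by (simp_all add: cong_def)
    then show ?thesis using e f by simp
  qed
  have proper: "?c x \<noteq> ?c y" if edge: "{x, y} \<in> edges ?G" for x y
  proof -
    obtain a b where ab: "{x, y} = {a, b}" "[b = a + 1] (mod N)"
      using doubled_cycle_edge_orientation[OF N(1) edge] by metis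
    have "?c a \<noteq> ?c b" using step(2)[OF ab(2)] c_eq[of a b] by argo
    then show ?thesis using ab(1) unfolding doubleton_eq_iff by metis
  qed
  have bound: "?c w < nat (2 * k)" for w
  proof -
    have "w mod 2 < 2" by simp
    then have "2 * v (w mod N) + w mod 2 < 2 * k" using v(2)[of "w mod N"] by linarith
    moreover have "0 \<le> 2 * v (w mod N) + w mod 2" using v(1)[of "w mod N"] by simp
    ultimately show ?thesis by (simp only: nat_less_eq_zless)
  qed
  show ?thesis
    unfolding harmonious_coloring_def proper_coloring_def
    by (intro conjI ballI allI impI) (rule bound, erule proper, rule distinct)
qed

section \<open>The harmonious chromatic number\<close>

theorem theorem13:
  fixes t :: nat and G :: "int graph" and n :: int and m :: nat
  assumes "t > 0" and "[int t = -1] (mod 4)"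
    and "n = int t * (int t - 1)"
    and "G = circulant_graph n {1, n div 2 - 1}"
    and "m = card (edges G)"
  shows "int (harmonious_chromatic_number G) = \<lceil>sqrt (2 * real m + 1 / 4) + 1 / 2\<rceil>"
proof -
  have "int t mod 4 = 3" using assms(2) by (simp add: cong_def)
  define r where "r = int t div 2"
  have t: "int t = 2 * r + 1" and "odd r" and r: "0 < r"
    using \<open>int t mod 4 = 3\<close> unfolding r_def by presburger+
  define N where "N = r * (2 * r + 1)"
  have n: "n = 2 * N" using assms(3) unfolding t N_def by algebra
  have "odd N" using \<open>odd r\<close> by (simp add: N_def)
  have "1 * 3 \<le> r * (2 * r + 1)" using r by (intro mult_mono) auto
  then have N: "3 \<le> N" by (simp add: N_def)
  have G: "G = circulant_graph (2 * N) {1, N - 1}" using assms(4) n by simp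
  have simple: "finite_simple_graph G" unfolding G
    by (rule circulant_graph_simple) (use N in auto)
  have "verts G \<noteq> {}" using N by (simp add: G circulant_graph_def)
  note lower = harmonious_chromatic_number_lower_bound[OF simple this, folded assms(5)]

  have "card {1, N - 1} = 2" using N by simp
  then have "m = nat (2 * N) * 2"
    unfolding assms(5) G by (subst card_circulant_edges) (use N in auto)
  then have "int m = 2 * int t * (int t - 1)" using N n assms(3) by simp
  then have m: "real m = 2 * real t * (real t - 1)"
    by (metis of_int_1 of_int_diff of_int_mult of_int_numeral of_int_of_nat_eq)
  have "1 < t" using t r by linarith
  \<comment> \<open>The counting bound exceeds \<open>2 t - 1\<close>, the next smaller integer.\<close>
  then have "(2 * real t - 3 / 2)\<^sup>2 < 2 * real m + 1 / 4"
    unfolding m by (simp add: power2_eq_square algebra_simps)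
  then have "2 * real t - 3 / 2 < sqrt (2 * real m + 1 / 4)" by (rule real_less_rsqrt)
  then have "int (2 * t) \<le> \<lceil>sqrt (2 * real m + 1 / 4) + 1 / 2\<rceil>"
    by (simp add: le_ceiling_iff)

  moreover have "harmonious_chromatic_number G \<le> 2 * t"
  proof -
    have "closed_trail (int t) N (walecki_circuit r)"
      unfolding t N_def by (rule walecki_circuit_closed_trail[OF r])
    from harmonious_coloring_from_closed_trail[OF N \<open>odd N\<close> this]
    have "\<exists>c. harmonious_coloring G (2 * t) c" unfolding G by (auto simp: nat_mult_distrib)
    then show ?thesis unfolding harmonious_chromatic_number_def by (rule Least_le)
  qed
  moreover have "\<lceil>sqrt (2 * real m + 1 / 4) + 1 / 2\<rceil> \<le> int (harmonious_chromatic_number G)"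
    using lower by (simp add: ceiling_le_iff)
  ultimately show ?thesis by linarith
qed

end
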